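(* Let $a\in\mathbb{R}$, $\alpha\in[0,1]$, $\mu\in\mathbb{R}$, and let $f$ be a function defined on $\mathbb{N}_a$. Then $$\left(\mathcal{K}_a\, {}^{AB}_{\;\;a}\nabla^{(-\alpha,\mu)}f\right)(z)=\left(\frac{1-\alpha}{B(\alpha)}+\frac{\alpha}{B(\alpha)}z^{-\alpha}\right)^{\mu}(\mathcal{K}_a f)(z).$$
   Context: Notation: $\mathbb{N}_a=\{a,a+1,a+2,\dots\}$, $\rho(s)=s-1$, $\nabla g(t)=g(t)-g(t-1)$. The rising function is $x^{\overline{\nu}}=\Gamma(x+\nu)/\Gamma(x)$ for $x\in\mathbb{R}\setminus\{\dots,-2,-1,0\}$, and $0^{\overline{\nu}}=0$. Left nabla fractional sum of order $\nu>0$: ${}_a\nabla^{-\nu}f(t)=\frac{1}{\Gamma(\nu)}\sum_{s=a+1}^{t}(t-\rho(s))^{\overline{\nu-1}}f(s)$ (an empty sum, i.e. the case $t\le a$, is $0$), and ${}_a\nabla^{-0}f=f$. $B(\alpha)$ is the (positive) normalisation function of Atangana--Baleanu (AB) calculus, with $B(0)=B(1)=1$. Iterated left AB fractional difference-sum of order $(-\alpha,\mu)$, for $\alpha\in[0,1]$, $\mu\in\mathbb{R}$ and a function $f$ on $\mathbb{N}_a$: $${}^{AB}_{\;\;a}\nabla^{(-\alpha,\mu)}f(t)=\sum_{k=0}^{\infty}\frac{\binom{\mu}{k}(1-\alpha)^{\mu-k}\alpha^k}{B(\alpha)^{\mu}}\;{}_a\nabla^{-k\alpha}f(t),$$ where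 $\binom{\mu}{k}=\mu(\mu-1)\cdots(\mu-k+1)/k!$ and $0^0=1$. In the limiting case $\alpha\to1$ the convention is ${}^{AB}_{\;\;a}\nabla^{(-1,\mu)}f={}_a\nabla^{-\mu}f$ and ${}^{AB}_{\;\;a}\nabla^{(-1,-\mu)}f={}_a\nabla^{\mu}f$ for $\mu>0$, where ${}_a\nabla^{\mu}=\nabla^{n}\,{}_a\nabla^{-(n-\mu)}$ with $n=\lfloor\mu\rfloor+1$ is the nabla fractional difference. Nabla discrete Laplace transform: $(\mathcal{K}_a f)(z)=\sum_{t=a+1}^{\infty}(1-z)^{t-a-1}f(t)$.
   Formalization: Added: |1-z|<1, convergence of (K_a f)(z), and, for 1/2≤α<1, convergence of the series defining the AB operator on N_a; without these the claim is undefined (for 1/2≤α<1 and μ not a natural number, that series converges only if f vanishes on N_{a+1}). *)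

theory Defs
  imports "HOL-Analysis.Analysis"
begin

text \<open>
  A function on $\{a, a+1, \dots\}$ is a total function on the reals; only its values on that
  set are ever used.
\<close>

definition nats_from :: "real \<Rightarrow> real set" where
  "nats_from a = range (\<lambda>n::nat. a + real n)"

definition rho :: "real \<Rightarrow> real" where
  "rho s = s - 1"

definition nabla :: "(real \<Rightarrow> 'a::real_normed_vector) \<Rightarrow> real \<Rightarrow> 'a" where
  "nabla g t = g t - g (t - 1)"

definition rising :: "real \<Rightarrow> real \<Rightarrow> real" where
  "rising x \<nu> = (if x = 0 then 0 else Gamma (x + \<nu>) / Gamma x)"

text \<open>Used for orders \<open>\<nu> \<ge> 0\<close> only.\<close>

definition nabla_sum :: "real \<Rightarrow> real \<Rightarrow> (real \<Rightarrow> 'a::real_normed_vector) \<Rightarrow> real \<Rightarrow> 'a" where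
  "nabla_sum a \<nu> f t =
     (if \<nu> = 0 then f t
      else (1 / Gamma \<nu>) *\<^sub>R
        (\<Sum>s\<in>{s \<in> nats_from (a + 1). s \<le> t}. rising (t - rho s) (\<nu> - 1) *\<^sub>R f s))"

text \<open>
  Used for orders \<open>\<mu> > 0\<close> only. The inner order \<open>n - \<mu>\<close> lies in $(0,1]$, so the inner function is
  an empty sum, i.e. zero, at the points \<open>t \<le> a\<close> that the \<open>n\<close>-fold difference may reach.
\<close>

definition nabla_diff :: "real \<Rightarrow> real \<Rightarrow> (real \<Rightarrow> 'a::real_normed_vector) \<Rightarrow> real \<Rightarrow> 'a" where
  "nabla_diff a \<mu> f =
     (let n = nat (\<lfloor>\<mu>\<rfloor> + 1) in (nabla ^^ n) (nabla_sum a (real n - \<mu>) f))"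

definition AB_term ::
  "(real \<Rightarrow> real) \<Rightarrow> real \<Rightarrow> real \<Rightarrow> real \<Rightarrow> (real \<Rightarrow> 'a::real_normed_vector) \<Rightarrow> real \<Rightarrow> nat \<Rightarrow> 'a" where
  "AB_term B a \<alpha> \<mu> f t k =
     ((\<mu> gchoose k) * (1 - \<alpha>) powr (\<mu> - real k) * \<alpha> ^ k / B \<alpha> powr \<mu>) *\<^sub>R
       nabla_sum a (real k * \<alpha>) f t"

text \<open>
  The iterated operator of order \<open>(-\<alpha>, \<mu>)\<close>: the series for \<open>\<alpha> < 1\<close>, and the limiting convention
  for \<open>\<alpha> = 1\<close>, where \<open>\<mu> = 0\<close> gives \<open>f\<close> itself.
\<close>

definition AB_nabla ::
  "(real \<Rightarrow> real) \<Rightarrow> real \<Rightarrow> real \<Rightarrow> real \<Rightarrow> (real \<Rightarrow> 'a::real_normed_vector) \<Rightarrow> real \<Rightarrow> 'a" where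
  "AB_nabla B a \<alpha> \<mu> f t =
     (if \<alpha> = 1 then (if 0 \<le> \<mu> then nabla_sum a \<mu> f t else nabla_diff a (- \<mu>) f t)
      else (\<Sum>k. AB_term B a \<alpha> \<mu> f t k))"

definition AB_exists ::
  "(real \<Rightarrow> real) \<Rightarrow> real \<Rightarrow> real \<Rightarrow> real \<Rightarrow> (real \<Rightarrow> 'a::real_normed_vector) \<Rightarrow> bool" where
  "AB_exists B a \<alpha> \<mu> f \<longleftrightarrow> \<alpha> = 1 \<or> (\<forall>t\<in>nats_from a. summable (AB_term B a \<alpha> \<mu> f t))"

text \<open>
  The nabla Laplace transform, with summation index \<open>n = t - a - 1\<close>; its value is meaningful
  only where the series converges.
\<close>

definition nabla_laplace :: "real \<Rightarrow> (real \<Rightarrow> complex) \<Rightarrow> complex \<Rightarrow> complex" where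
  "nabla_laplace a f z = (\<Sum>n. (1 - z) ^ n * f (a + 1 + real n))"

definition nabla_laplace_exists :: "real \<Rightarrow> (real \<Rightarrow> complex) \<Rightarrow> complex \<Rightarrow> bool" where
  "nabla_laplace_exists a f z \<longleftrightarrow> summable (\<lambda>n. (1 - z) ^ n * f (a + 1 + real n))"

end

theory Submission
  imports Defs "HOL-Complex_Analysis.Complex_Analysis"
begin

text \<open>
  Put \<open>w = 1 - z\<close>, so that the transform of \<open>f\<close> is the power series with coefficients
  \<open>f (a + 1 + n)\<close> evaluated at \<open>w\<close>. A nabla sum of order \<open>\<nu>\<close> convolves these coefficients with
  the Taylor coefficients of \<open>(1 - w) powr (-\<nu>)\<close> (lemmas \<open>nabla_sum_conv\<close>, \<open>kernel_sums\<close>), so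
  it multiplies the transform by \<open>z powr (-\<nu>)\<close>. The transform of \<open>f\<close> may converge only
  conditionally at \<open>z\<close>, while the Taylor series of the kernel converges absolutely in the open unit
  disc; the product rule needed is therefore that of Mertens. For \<open>\<alpha> = 1\<close> this, together with the
  rule that \<open>nabla\<close> multiplies transforms by \<open>z\<close>, is the whole proof.

  For \<open>\<alpha> < 1\<close> put \<open>x = \<alpha> / (1 - \<alpha>)\<close>. Up to the constant \<open>((1 - \<alpha>) / B \<alpha>) powr \<mu>\<close>, the operator
  is the convolution with \<open>g n = (\<Sum>k. (\<mu> gchoose k) * x ^ k * nabla_kernel (k * \<alpha>) n)\<close>, and the
  claim is that \<open>g\<close> generates \<open>h w = (1 + x * (1 - w) powr (-\<alpha>)) powr \<mu>\<close>. Summing over \<open>n\<close>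
  before \<open>k\<close> gives exactly the binomial series of \<open>h w\<close>. The two summations may be exchanged where
  \<open>x * (1 - norm w) powr (-\<alpha>)\<close> is below \<open>1\<close>, which for \<open>x < 1\<close>, that is \<open>\<alpha> < 1/2\<close>, is a
  neighbourhood of \<open>w = 0\<close>, or when \<open>\<mu>\<close> is a natural number, so that the series over \<open>k\<close>
  terminates. The rest of the disc is reached by uniqueness of Taylor coefficients: as
  \<open>\<alpha> \<le> 1\<close>, the power \<open>(1 - w) powr (-\<alpha>)\<close> has positive real part for \<open>norm w < 1\<close>, so \<open>h\<close> is
  holomorphic in the unit disc and its Taylor series converges to it there (\<open>coefficient_series\<close>).

  There remain \<open>1/2 \<le> \<alpha> < 1\<close> and \<open>\<mu>\<close> not a natural number. Here the series that defines the operator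
  can converge at all points only if \<open>f\<close> vanishes on \<open>{a + 1, a + 2, \<dots>}\<close>: otherwise convergence at
  the points from the first nonzero value on would make \<open>(\<mu> gchoose k) * x ^ k * k ^ M\<close> tend to \<open>0\<close>
  for every \<open>M\<close>, whereas \<open>\<mu> gchoose k\<close> is of the order of \<open>k powr (-\<mu> - 1)\<close> and \<open>x \<ge> 1\<close>
  (\<open>AB_exists_imp_nat\<close>). So in this case both sides are zero.
\<close>

section \<open>The convolution kernel of nabla sums\<close>

text \<open>
  Agrees with the rising-function weight of the nabla sum for \<open>\<nu> > 0\<close>. Unlike the quotient of Gamma
  values it is also right at \<open>\<nu> = 0\<close>, where it is the unit of convolution, and it is a polynomial in
  \<open>\<nu>\<close>.
\<close>

definition nabla_kernel :: "real \<Rightarrow> nat \<Rightarrow> real" where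
  "nabla_kernel \<nu> n = pochhammer \<nu> n / fact n"

lemma kernel_zero_order: "nabla_kernel 0 n = (if n = 0 then 1 else 0)"
  by (simp add: nabla_kernel_def pochhammer_0_left)

lemma kernel_nonneg: "0 \<le> \<nu> \<Longrightarrow> 0 \<le> nabla_kernel \<nu> n"
  unfolding nabla_kernel_def pochhammer_prod by (intro divide_nonneg_nonneg prod_nonneg) auto

text \<open>
  Used to recover powers of \<open>k\<close> from the kernel at order \<open>k * \<alpha>\<close>.
\<close>

lemma kernel_ge_power:
  assumes "0 \<le> \<nu>"
  shows "\<nu> ^ n / fact n \<le> nabla_kernel \<nu> n"
proof -
  have "\<nu> ^ n \<le> pochhammer \<nu> n"
  proof (induction n)
    case (Suc n)
    have "\<nu> ^ n * \<nu> \<le> pochhammer \<nu> n * (\<nu> + real n)"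
      using assms Suc by (intro mult_mono) (auto simp: pochhammer_prod intro!: prod_nonneg)
    then show ?case
      by (simp add: pochhammer_Suc mult.commute)
  qed simp
  then show ?thesis
    by (simp add: nabla_kernel_def divide_right_mono)
qed

lemma kernel_eq_rising:
  assumes "0 < \<nu>"
  shows "nabla_kernel \<nu> i = rising (real i + 1) (\<nu> - 1) / Gamma \<nu>"
proof -
  have "pochhammer \<nu> i = Gamma (\<nu> + real i) / Gamma \<nu>"
    using assms by (intro pochhammer_Gamma) (auto elim!: nonpos_Ints_cases)
  moreover have "Gamma (real i + 1) = fact i"
    using Gamma_fact[of i, where 'a=real] by (simp add: add.commute)
  moreover have "real i + 1 + (\<nu> - 1) = \<nu> + real i" by simp
  ultimately show ?thesis
    by (simp add: nabla_kernel_def rising_def ac_simps)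
qed

text \<open>
  Identifies the kernel with the terms of the binomial series of \<open>(1 - w) powr (-\<nu>)\<close>.
\<close>

lemma gbinomial_minus_eq_kernel:
  "(of_real (- \<nu>) gchoose n) * (- w) ^ n = of_real (nabla_kernel \<nu> n) * (w::'a::{real_normed_field}) ^ n"
proof -
  have "(- 1) ^ n * (- 1) ^ n = (1::'a)"
    by (simp flip: power_mult_distrib)
  then have "(- 1) ^ n * c * ((- 1) ^ n * v) = c * v" for c v :: 'a
    by (metis mult.assoc mult.left_commute mult.left_neutral)
  from this[of "of_real (pochhammer \<nu> n) / fact n" "w ^ n"] show ?thesis
    unfolding gbinomial_pochhammer nabla_kernel_def power_minus[of w]
    by (simp add: pochhammer_of_real)
qed

lemma kernel_sums:
  fixes w :: complex
  assumes "norm w < 1"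
  shows "(\<lambda>n. of_real (nabla_kernel \<nu> n) * w ^ n) sums ((1 - w) powr (- of_real \<nu>))"
  using gen_binomial_complex[of "- w" "of_real (- \<nu>)"] assms
  unfolding gbinomial_minus_eq_kernel by simp

lemma kernel_sums_real:
  fixes y :: real
  assumes "\<bar>y\<bar> < 1"
  shows "(\<lambda>n. nabla_kernel \<nu> n * y ^ n) sums ((1 - y) powr (- \<nu>))"
  using gen_binomial_real[of "- y" "of_real (- \<nu>)"] assms
  unfolding gbinomial_minus_eq_kernel by simp

lemma points_up_to: "{s \<in> nats_from (a + 1). s \<le> a + 1 + real m} = (\<lambda>i. a + 1 + real i) ` {..m}"
  by (auto simp: nats_from_def)

lemma nabla_sum_conv:
  fixes f :: "real \<Rightarrow> 'a::real_normed_vector"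
  assumes "0 \<le> \<nu>"
  shows "nabla_sum a \<nu> f (a + 1 + real m) =
    (\<Sum>i\<le>m. nabla_kernel \<nu> i *\<^sub>R f (a + 1 + real (m - i)))"
proof (cases "\<nu> = 0")
  case True
  have "(\<Sum>i\<le>m. nabla_kernel 0 i *\<^sub>R f (a + 1 + real (m - i))) =
      (\<Sum>i\<in>{0}. f (a + 1 + real (m - i)))"
    by (rule sum.mono_neutral_cong_right) (auto simp: kernel_zero_order)
  then show ?thesis
    using True by (simp add: nabla_sum_def)
next
  case False
  with assms have \<nu>: "0 < \<nu>" by simp
  have "nabla_sum a \<nu> f (a + 1 + real m) = (1 / Gamma \<nu>) *\<^sub>R
      (\<Sum>j\<le>m. rising (a + 1 + real m - rho (a + 1 + real j)) (\<nu> - 1) *\<^sub>R f (a + 1 + real j))"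
    unfolding nabla_sum_def points_up_to using \<nu>
    by (subst sum.reindex) (auto simp: inj_on_def)
  also have "\<dots> = (\<Sum>j\<le>m. nabla_kernel \<nu> (m - j) *\<^sub>R f (a + 1 + real j))"
    unfolding scaleR_sum_right
  proof (rule sum.cong)
    fix j assume "j \<in> {..m}"
    then have shift: "a + 1 + real m - rho (a + 1 + real j) = real (m - j) + 1"
      by (simp add: rho_def of_nat_diff)
    show "(1 / Gamma \<nu>) *\<^sub>R rising (a + 1 + real m - rho (a + 1 + real j)) (\<nu> - 1) *\<^sub>R
        f (a + 1 + real j) = nabla_kernel \<nu> (m - j) *\<^sub>R f (a + 1 + real j)"
      unfolding shift by (simp add: kernel_eq_rising[OF \<nu>])
  qed simp
  also have "\<dots> = (\<Sum>i\<le>m. nabla_kernel \<nu> i *\<^sub>R f (a + 1 + real (m - i)))"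
    by (rule sum.reindex_bij_witness[of _ "\<lambda>i. m - i" "\<lambda>i. m - i"]) auto
  finally show ?thesis .
qed

lemma nabla_sum_before_start:
  assumes "\<nu> \<noteq> 0"
  shows "nabla_sum a \<nu> f (a - real j) = 0"
proof -
  have "{s \<in> nats_from (a + 1). s \<le> a - real j} = {}"
    by (auto simp: nats_from_def)
  then show ?thesis
    using assms by (simp add: nabla_sum_def del: Collect_empty_eq)
qed

section \<open>Transforms of convolutions and of differences\<close>

text \<open>
  Turns existence and value of a transform into one statement, to which the rules for \<open>sums\<close> apply.
\<close>

lemma sums_iff_nabla_laplace:
  "(\<lambda>n. (1 - z) ^ n * f (a + 1 + real n)) sums L \<longleftrightarrow>
    nabla_laplace_exists a f z \<and> nabla_laplace a f z = L"
  by (auto simp: nabla_laplace_exists_def nabla_laplace_def sums_iff)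

text \<open>
  The Cauchy product needs absolute convergence of one factor only: its partial sums are
  \<open>\<Sum>i\<le>N. x i * S (N - i)\<close> with \<open>S\<close> the bounded partial sums of \<open>y\<close>, so Tannery's theorem, with
  majorant \<open>norm (x i) * K\<close>, allows the limit \<open>S (N - i) \<longlonglongrightarrow> Y\<close> to be taken termwise.
\<close>

lemma Mertens_sums:
  fixes x y :: "nat \<Rightarrow> 'a::{real_normed_field, banach}"
  assumes x: "summable (\<lambda>n. norm (x n))" and y: "y sums Y"
  shows "(\<lambda>m. \<Sum>i\<le>m. x i * y (m - i)) sums (suminf x * Y)"
proof -
  define S where "S m = (\<Sum>j\<le>m. y j)" for m
  define t where "t i m = (if i \<le> m then x i * S (m - i) else 0)" for i m
  have S: "S \<longlonglongrightarrow> Y"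
    using y unfolding sums_def_le S_def .
  then obtain K where K: "\<And>m. norm (S m) \<le> K"
    using convergent_imp_Bseq[of S] unfolding Bseq_def convergent_def by blast
  have partial: "(\<Sum>m\<le>N. \<Sum>i\<le>m. x i * y (m - i)) = suminf (\<lambda>i. t i N)" for N
  proof -
    have "(\<Sum>m\<le>N. \<Sum>i\<le>m. x i * y (m - i)) = (\<Sum>i\<le>N. \<Sum>j\<le>N - i. x i * y j)"
    proof (induction N)
      case (Suc N)
      have "(\<Sum>i\<le>N. \<Sum>j\<le>Suc N - i. x i * y j) =
          (\<Sum>i\<le>N. (\<Sum>j\<le>N - i. x i * y j) + x i * y (Suc N - i))"
        by (intro sum.cong) (auto simp: Suc_diff_le)
      then show ?case
        by (simp add: Suc sum.distrib)
    qed simp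
    also have "\<dots> = (\<Sum>i\<le>N. t i N)"
      by (simp add: t_def S_def sum_distrib_left)
    also have "\<dots> = suminf (\<lambda>i. t i N)"
      by (rule suminf_finite[symmetric]) (auto simp: t_def)
    finally show ?thesis .
  qed
  have "((\<lambda>N. suminf (\<lambda>i. t i N)) \<longlongrightarrow> suminf (\<lambda>i. x i * Y)) sequentially"
  proof (rule tannerys_theorem[THEN conjunct2, THEN conjunct2])
    fix i
    have "(\<lambda>N. x i * S (N - i)) \<longlonglongrightarrow> x i * Y"
      by (intro tendsto_mult_left)
        (rule filterlim_compose[OF S filterlim_minus_const_nat_at_top])
    then show "(\<lambda>N. t i N) \<longlonglongrightarrow> x i * Y"
      by (rule Lim_transform_eventually)
        (use eventually_ge_at_top[of i] in eventually_elim, simp add: t_def)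
  next
    have "norm (t i N) \<le> norm (x i) * K" for i N
      using K[of 0] K[of "N - i"]
      by (auto simp: t_def norm_mult intro!: mult_left_mono mult_nonneg_nonneg
          intro: order_trans[OF norm_ge_zero])
    then show "\<forall>\<^sub>F (i, N) in sequentially \<times>\<^sub>F sequentially. norm (t i N) \<le> norm (x i) * K"
      by (simp add: case_prod_unfold)
    show "summable (\<lambda>i. norm (x i) * K)"
      using x by (rule summable_mult2)
  qed simp
  then show ?thesis
    unfolding sums_def_le partial suminf_mult2[OF summable_norm_cancel[OF x]] .
qed

lemma laplace_convolution:
  fixes f h :: "real \<Rightarrow> complex" and g :: "nat \<Rightarrow> real" and G :: "complex \<Rightarrow> complex"
  assumes g_sums: "\<And>w. norm w < 1 \<Longrightarrow> (\<lambda>n. of_real (g n) * w ^ n) sums G w"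
    and z: "norm (1 - z) < 1" and f: "nabla_laplace_exists a f z"
    and h: "\<And>m. h (a + 1 + real m) = (\<Sum>i\<le>m. g i *\<^sub>R f (a + 1 + real (m - i)))"
  shows "nabla_laplace_exists a h z \<and> nabla_laplace a h z = G (1 - z) * nabla_laplace a f z"
proof -
  have f_sums: "(\<lambda>n. (1 - z) ^ n * f (a + 1 + real n)) sums nabla_laplace a f z"
    using f by (simp add: sums_iff_nabla_laplace)
  (* A radius s strictly between |1 - z| and 1 turns convergence into absolute convergence. *)
  obtain s :: real where s: "norm (1 - z) < s" "s < 1"
    using z dense by blast
  then have "0 < s"
    using norm_ge_zero[of "1 - z"] by linarith
  then have "summable (\<lambda>n. of_real (g n) * (of_real s :: complex) ^ n)"
    using s g_sums[of "of_real s"] by (simp add: sums_iff)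
  then have g: "summable (\<lambda>n. norm (of_real (g n) * (1 - z) ^ n))"
    by (rule powser_insidea) (use s \<open>0 < s\<close> in simp)
  have "(\<Sum>i\<le>m. of_real (g i) * (1 - z) ^ i * ((1 - z) ^ (m - i) * f (a + 1 + real (m - i)))) =
      (1 - z) ^ m * h (a + 1 + real m)" for m
    unfolding h sum_distrib_left
  proof (rule sum.cong)
    fix i assume "i \<in> {..m}"
    then have "(1 - z) ^ m = (1 - z) ^ i * (1 - z) ^ (m - i)"
      by (simp flip: power_add)
    then show "of_real (g i) * (1 - z) ^ i * ((1 - z) ^ (m - i) * f (a + 1 + real (m - i))) =
        (1 - z) ^ m * g i *\<^sub>R f (a + 1 + real (m - i))"
      by (simp add: scaleR_conv_of_real mult_ac)
  qed simp
  with Mertens_sums[OF g f_sums] sums_unique[OF g_sums[OF z]]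
  have "(\<lambda>m. (1 - z) ^ m * h (a + 1 + real m)) sums (G (1 - z) * nabla_laplace a f z)"
    by simp
  then show ?thesis
    by (simp only: sums_iff_nabla_laplace)
qed

text \<open>
  The nabla sum is a convolution whose kernel generates \<open>(1 - w) powr (-\<nu>)\<close>, here at \<open>w = 1 - z\<close>.
\<close>

lemma laplace_nabla_sum:
  assumes "0 \<le> \<nu>" and z: "norm (1 - z) < 1" and f: "nabla_laplace_exists a f z"
  shows "nabla_laplace_exists a (nabla_sum a \<nu> f) z \<and>
    nabla_laplace a (nabla_sum a \<nu> f) z = z powr (- of_real \<nu>) * nabla_laplace a f z"
  using laplace_convolution[OF kernel_sums z f nabla_sum_conv[OF \<open>0 \<le> \<nu>\<close>]] by simp

text \<open>
  The backward shift multiplies the transform by \<open>1 - z\<close>, up to the boundary term \<open>f a\<close>, which the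
  hypothesis removes.
\<close>

lemma laplace_nabla:
  assumes f: "nabla_laplace_exists a f z" and "f a = 0"
  shows "nabla_laplace_exists a (nabla f) z \<and> nabla_laplace a (nabla f) z = z * nabla_laplace a f z"
proof -
  let ?L = "nabla_laplace a f z"
  have f_sums: "(\<lambda>n. (1 - z) ^ n * f (a + 1 + real n)) sums ?L"
    using f by (simp add: sums_iff_nabla_laplace)
  have "(\<lambda>n. (1 - z) ^ Suc n * f (a + real (Suc n))) sums ((1 - z) * ?L)"
    using sums_mult[OF f_sums, of "1 - z"] by (simp add: algebra_simps)
  then have "(\<lambda>n. (1 - z) ^ n * f (a + real n)) sums ((1 - z) * ?L)"
    using \<open>f a = 0\<close> sums_Suc_iff[of "\<lambda>n. (1 - z) ^ n * f (a + real n)"] by simp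
  from sums_diff[OF f_sums this]
  have "(\<lambda>n. (1 - z) ^ n * nabla f (a + 1 + real n)) sums (z * ?L)"
    by (simp add: nabla_def algebra_simps)
  then show ?thesis
    by (simp add: sums_iff_nabla_laplace)
qed

text \<open>
  Each difference looks one step further to the left, so that the boundary terms vanish at every stage
  when \<open>f\<close> vanishes at all points \<open>a, a - 1, \<dots>\<close>.
\<close>

lemma laplace_nabla_funpow:
  assumes f: "nabla_laplace_exists a f z" and start: "\<And>j. f (a - real j) = 0"
  shows "nabla_laplace_exists a ((nabla ^^ n) f) z \<and>
    nabla_laplace a ((nabla ^^ n) f) z = z ^ n * nabla_laplace a f z"
proof -
  have vanish: "(nabla ^^ n) f (a - real j) = 0" for n j
  proof (induction n arbitrary: j)
    case (Suc n)
    show ?case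
      using Suc[of j] Suc[of "Suc j"] by (simp add: nabla_def algebra_simps)
  qed (simp add: start)
  show ?thesis
  proof (induction n)
    case (Suc n)
    then show ?case
      using laplace_nabla[of a "(nabla ^^ n) f" z] vanish[of n 0] by simp
  qed (simp add: f)
qed

text \<open>
  The inner nabla sum has positive order \<open>n - \<mu>\<close>, hence is empty at and before \<open>a\<close>, so the
  \<open>n\<close> outer differences contribute exactly \<open>z ^ n\<close>.
\<close>

lemma laplace_nabla_diff:
  assumes "0 < \<mu>" and z: "norm (1 - z) < 1" and f: "nabla_laplace_exists a f z"
  shows "nabla_laplace_exists a (nabla_diff a \<mu> f) z \<and>
    nabla_laplace a (nabla_diff a \<mu> f) z = z powr of_real \<mu> * nabla_laplace a f z"
proof -
  define n where "n = nat (\<lfloor>\<mu>\<rfloor> + 1)"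
  have n: "0 < real n - \<mu>"
    using \<open>0 < \<mu>\<close> unfolding n_def by linarith
  have [simp]: "z \<noteq> 0"
    using z by auto
  have "nabla_laplace_exists a (nabla_sum a (real n - \<mu>) f) z \<and>
      nabla_laplace a (nabla_sum a (real n - \<mu>) f) z =
        z powr (- of_real (real n - \<mu>)) * nabla_laplace a f z"
    using n by (intro laplace_nabla_sum z f) simp
  moreover have "nabla_sum a (real n - \<mu>) f (a - real j) = 0" for j
    using n by (intro nabla_sum_before_start) simp
  moreover have "z ^ n * z powr (- of_real (real n - \<mu>)) = z powr of_real \<mu>"
  proof -
    have "z ^ n = z powr of_nat n"
      by simp
    then have "z ^ n * z powr (- of_real (real n - \<mu>)) =
        z powr (of_nat n + - of_real (real n - \<mu>))"
      by (simp only: powr_add)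
    then show ?thesis
      by simp
  qed
  ultimately show ?thesis
    using laplace_nabla_funpow[of a "nabla_sum a (real n - \<mu>) f" z n]
    by (simp add: nabla_diff_def n_def[symmetric] mult.assoc[symmetric])
qed

section \<open>Series in powers of the kernel's generating function\<close>

lemma powr_minus_mult_of_nat:
  "(w::complex) \<noteq> 0 \<Longrightarrow> w powr (- of_real (real k * \<alpha>)) = (w powr (- of_real \<alpha>)) ^ k"
  by (simp add: powr_def mult_ac flip: exp_of_nat_mult)

text \<open>
  On the disc of radius \<open>1 - 1 / r\<close> the distance of \<open>w\<close> from \<open>1\<close> is at least \<open>1 / r\<close>.
\<close>

lemma norm_kernel_generating_function_le:
  fixes w :: complex
  assumes "1 \<le> r" "0 \<le> \<alpha>" "\<alpha> \<le> 1" "norm w \<le> 1 - 1 / r"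
  shows "norm ((1 - w) powr (- of_real \<alpha>)) \<le> r"
proof -
  have "1 / r \<le> norm (1 - w)"
    using norm_triangle_ineq2[of 1 w] assms by simp
  then have "norm (1 - w) powr (- \<alpha>) \<le> (1 / r) powr (- \<alpha>)"
    using assms by (intro powr_mono2') auto
  also have "\<dots> = r powr \<alpha>"
    using assms by (simp add: powr_divide powr_minus field_simps)
  also have "\<dots> \<le> r"
    using assms powr_mono[of \<alpha> 1 r] by simp
  finally show ?thesis
    by (simp add: norm_powr_real_powr')
qed

text \<open>
  Expansions of a function \<open>h\<close> in powers of \<open>u = (1 - w) powr (-\<alpha>)\<close>. At \<open>w = 0\<close> the value of \<open>u\<close>
  is \<open>1\<close>, which is why the coefficients \<open>d\<close> have to be absolutely summable with some weight
  \<open>r > 1\<close>: only then is a neighbourhood of \<open>w = 0\<close> covered.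
\<close>

context
  fixes d :: "nat \<Rightarrow> real" and \<alpha> r :: real and h :: "complex \<Rightarrow> complex"
  assumes d: "summable (\<lambda>k. \<bar>d k\<bar> * r ^ k)" and r: "1 < r"
    and \<alpha>: "0 \<le> \<alpha>" "\<alpha> \<le> 1"
    and expand: "\<And>w. norm w < 1 \<Longrightarrow> norm ((1 - w) powr (- of_real \<alpha>)) \<le> r \<Longrightarrow>
      (\<lambda>k. of_real (d k) * ((1 - w) powr (- of_real \<alpha>)) ^ k) sums h w"
begin

text \<open>
  The absolute values of the double series are again of the same kind, with \<open>norm w\<close> in place of \<open>w\<close>,
  because the kernel is nonnegative; its rows then sum to \<open>\<bar>d k\<bar> * q ^ k\<close> with \<open>q \<le> r\<close>. So the
  order of summation may be exchanged, and the row sums give the expansion of \<open>h w\<close>.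
\<close>

lemma rearrangement_near_0:
  assumes w: "norm w \<le> 1 - 1 / r"
  shows "(\<lambda>k. of_real (d k * nabla_kernel (real k * \<alpha>) n) * w ^ n) summable_on UNIV"
    and "((\<lambda>n. infsum (\<lambda>k. of_real (d k * nabla_kernel (real k * \<alpha>) n) * w ^ n) UNIV) has_sum h w) UNIV"
proof -
  define F where "F = (\<lambda>(k, n). of_real (d k * nabla_kernel (real k * \<alpha>) n) * w ^ n)"
  define q where "q = (1 - norm w) powr (- \<alpha>)"
  have w1: "norm w < 1"
    using w r by (smt (verit) divide_pos_pos)
  have q: "0 < q" "q \<le> r"
  proof -
    have "norm ((1 - of_real (norm w)) powr (- of_real \<alpha> :: complex)) \<le> r"
      using w r \<alpha> by (intro norm_kernel_generating_function_le) auto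
    moreover have "norm (1 - of_real (norm w) :: complex) = 1 - norm w"
      using w1 by (metis norm_of_real of_real_1 of_real_diff abs_of_pos diff_gt_0_iff_gt)
    ultimately show "q \<le> r"
      by (simp add: q_def norm_powr_real_powr')
    show "0 < q"
      using w1 by (simp add: q_def)
  qed
  have qk: "(1 - norm w) powr (- (real k * \<alpha>)) = q ^ k" for k
    using w1 by (simp add: q_def powr_power mult.commute)
  have rows_norm: "((\<lambda>n. norm (F (k, n))) has_sum (\<bar>d k\<bar> * q ^ k)) UNIV" for k
  proof (rule sums_nonneg_imp_has_sum)
    have "(\<lambda>n. \<bar>d k\<bar> * (nabla_kernel (real k * \<alpha>) n * norm w ^ n)) sums (\<bar>d k\<bar> * q ^ k)"
      using kernel_sums_real[of "norm w" "real k * \<alpha>"] w1 by (intro sums_mult) (simp add: qk)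
    then show "(\<lambda>n. norm (F (k, n))) sums (\<bar>d k\<bar> * q ^ k)"
      using \<alpha> by (simp add: F_def norm_mult norm_power abs_mult kernel_nonneg mult.assoc)
  qed simp
  have "summable (\<lambda>k. norm (\<bar>d k\<bar> * q ^ k))"
    by (rule summable_comparison_test[OF _ d])
      (use q in \<open>auto simp: abs_mult power_abs intro!: mult_left_mono power_mono\<close>)
  then have "(\<lambda>k. \<bar>d k\<bar> * q ^ k) summable_on UNIV"
    by (rule norm_summable_imp_summable_on)
  then have "(\<lambda>x. norm (F x)) summable_on (UNIV \<times> UNIV)"
    using rows_norm by (intro summable_on_SigmaI[where g = "\<lambda>k. \<bar>d k\<bar> * q ^ k"]) auto
  then have F: "F summable_on (UNIV \<times> UNIV)"
    by (rule abs_summable_summable)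
  then obtain S where S: "(F has_sum S) (UNIV \<times> UNIV)"
    by (auto simp: summable_on_def)
  have rows: "((\<lambda>n. F (k, n)) has_sum (of_real (d k) * ((1 - w) powr (- of_real \<alpha>)) ^ k)) UNIV" for k
  proof (rule norm_summable_imp_has_sum)
    show "summable (\<lambda>n. norm (F (k, n)))"
      using rows_norm[of k] by (auto dest: has_sum_imp_sums simp: sums_iff)
    have "(\<lambda>n. of_real (d k) * (of_real (nabla_kernel (real k * \<alpha>) n) * w ^ n)) sums
        (of_real (d k) * (1 - w) powr (- of_real (real k * \<alpha>)))"
      by (intro sums_mult kernel_sums w1)
    moreover have "1 - w \<noteq> 0"
      using w1 by auto
    ultimately show "(\<lambda>n. F (k, n)) sums (of_real (d k) * ((1 - w) powr (- of_real \<alpha>)) ^ k)"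
      by (simp add: F_def mult.assoc flip: powr_minus_mult_of_nat)
  qed
  from S rows have "((\<lambda>k. of_real (d k) * ((1 - w) powr (- of_real \<alpha>)) ^ k) has_sum S) UNIV"
    by (rule has_sum_SigmaD)
  then have "(\<lambda>k. of_real (d k) * ((1 - w) powr (- of_real \<alpha>)) ^ k) sums S"
    by (rule has_sum_imp_sums)
  moreover have "norm ((1 - w) powr (- of_real \<alpha>)) \<le> r"
    using w r \<alpha> by (intro norm_kernel_generating_function_le) auto
  ultimately have "S = h w"
    using expand[OF w1] sums_unique2 by blast
  have swapped: "((\<lambda>(n, k). F (k, n)) has_sum S) (UNIV \<times> UNIV)"
    using S by (subst (asm) has_sum_swap)
  have cols: "(\<lambda>k. F (k, n)) summable_on UNIV" for n
    using swapped summable_on_SigmaD1[of "\<lambda>n k. F (k, n)" UNIV "\<lambda>_. UNIV" n]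
    by (auto simp: summable_on_def)
  then show "(\<lambda>k. of_real (d k * nabla_kernel (real k * \<alpha>) n) * w ^ n) summable_on UNIV"
    by (simp add: F_def)
  have "((\<lambda>n. infsum (\<lambda>k. F (k, n)) UNIV) has_sum S) UNIV"
    using swapped by (rule has_sum_SigmaD) (use cols in simp)
  then show "((\<lambda>n. infsum (\<lambda>k. of_real (d k * nabla_kernel (real k * \<alpha>) n) * w ^ n) UNIV) has_sum h w) UNIV"
    by (simp add: F_def \<open>S = h w\<close>)
qed

text \<open>
  The columns of the double series at one point \<open>w = \<delta> \<noteq> 0\<close> of the small disc already give this.
\<close>

lemma summable_coefficient:
  "summable (\<lambda>k. d k * nabla_kernel (real k * \<alpha>) n)"
proof -
  define \<delta> where "\<delta> = 1 - 1 / r"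
  have \<delta>: "0 < \<delta>"
    using r by (simp add: \<delta>_def)
  have "(\<lambda>k. of_real (d k * nabla_kernel (real k * \<alpha>) n) * (of_real \<delta> :: complex) ^ n) summable_on UNIV"
    by (rule rearrangement_near_0) (use \<delta> in \<open>simp only: norm_of_real \<delta>_def abs_of_pos order_refl\<close>)
  then have "summable (\<lambda>k. of_real (d k * nabla_kernel (real k * \<alpha>) n * \<delta> ^ n) :: complex)"
    by (simp add: summable_on_imp_summable)
  then have "summable (\<lambda>k. d k * nabla_kernel (real k * \<alpha>) n * \<delta> ^ n)"
    by (simp only: summable_of_real_iff)
  from summable_mult2[OF this, of "1 / \<delta> ^ n"] show ?thesis
    using \<delta> by simp
qed

lemma coefficient_series_near_0:
  assumes w: "norm w \<le> 1 - 1 / r"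
  shows "(\<lambda>n. of_real (\<Sum>k. d k * nabla_kernel (real k * \<alpha>) n) * w ^ n) sums h w"
proof -
  have "infsum (\<lambda>k. of_real (d k * nabla_kernel (real k * \<alpha>) n) * w ^ n) UNIV =
      of_real (\<Sum>k. d k * nabla_kernel (real k * \<alpha>) n) * w ^ n" for n
  proof -
    have "(\<lambda>k. of_real (d k * nabla_kernel (real k * \<alpha>) n) * w ^ n) sums
        infsum (\<lambda>k. of_real (d k * nabla_kernel (real k * \<alpha>) n) * w ^ n) UNIV"
      using rearrangement_near_0(1)[OF w] by (intro has_sum_imp_sums has_sum_infsum)
    moreover have "(\<lambda>k. of_real (d k * nabla_kernel (real k * \<alpha>) n) * w ^ n) sums
        (of_real (\<Sum>k. d k * nabla_kernel (real k * \<alpha>) n) * w ^ n)"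
      by (intro sums_mult2 sums_of_real summable_sums summable_coefficient)
    ultimately show ?thesis
      by (rule sums_unique2)
  qed
  then show ?thesis
    using rearrangement_near_0(2)[OF w] by (auto dest: has_sum_imp_sums)
qed

text \<open>
  Near \<open>0\<close> the power series represents \<open>h\<close>, so its coefficients are the Taylor coefficients of
  \<open>h\<close>, and the Taylor series of a holomorphic function represents it on the whole disc. This
  is how the identity passes beyond the region where the double series converges absolutely.
\<close>

lemma coefficient_series:
  assumes holo: "h holomorphic_on ball 0 1" and w: "norm w < 1"
  shows "(\<lambda>n. of_real (\<Sum>k. d k * nabla_kernel (real k * \<alpha>) n) * w ^ n) sums h w"
proof -
  define G :: "complex fps" where "G = Abs_fps (\<lambda>n. of_real (\<Sum>k. d k * nabla_kernel (real k * \<alpha>) n))"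
  define \<delta> where "\<delta> = 1 - 1 / r"
  have \<delta>: "0 < \<delta>"
    using r by (simp add: \<delta>_def)
  have near: "(\<lambda>n. fps_nth G n * v ^ n) sums h v" if "norm v \<le> \<delta>" for v
    using coefficient_series_near_0[of v] that by (simp add: G_def \<delta>_def)
  have "h has_fps_expansion G"
  proof (rule has_fps_expansionI)
    have "eventually (\<lambda>v. v \<in> ball 0 \<delta>) (nhds (0::complex))"
      using \<delta> by (intro eventually_nhds_in_open) auto
    then show "eventually (\<lambda>v. (\<lambda>n. fps_nth G n * v ^ n) sums h v) (nhds 0)"
      by eventually_elim (simp add: near)
  qed
  then have "of_real (\<Sum>k. d k * nabla_kernel (real k * \<alpha>) n) = (deriv ^^ n) h 0 / fact n" for n
    using fps_nth_fps_expansion[of h G n] by (simp add: G_def)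
  then show ?thesis
    using holomorphic_power_series[OF holo, of w] w by simp
qed

end

section \<open>The operator series\<close>

text \<open>
  The argument of \<open>z\<close> lies strictly between \<open>-pi / 2\<close> and \<open>pi / 2\<close>, and a factor \<open>\<alpha> \<le> 1\<close> keeps
  it there. This keeps the principal branches of the powers below away from their cut.
\<close>

lemma Re_powr_minus_pos:
  assumes "0 < Re z" "0 \<le> \<alpha>" "\<alpha> \<le> 1"
  shows "0 < Re (z powr (- of_real \<alpha>))"
proof -
  have z: "z \<noteq> 0"
    using assms by auto
  then have "\<bar>Im (Ln z)\<bar> < pi / 2"
    using Re_Ln_pos_lt assms by blast
  moreover have "\<bar>\<alpha> * Im (Ln z)\<bar> \<le> \<bar>Im (Ln z)\<bar>"
    using assms by (simp add: abs_mult mult_left_le_one_le)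
  ultimately have "0 < cos (\<alpha> * Im (Ln z))"
    by (intro cos_gt_zero_pi) linarith+
  then show ?thesis
    using z by (simp add: powr_def Re_exp)
qed

lemma Re_symbol_pos:
  assumes "0 < Re z" "0 \<le> \<alpha>" "\<alpha> \<le> 1" "0 \<le> x"
  shows "0 < Re (1 + of_real x * z powr (- of_real \<alpha>))"
  using Re_powr_minus_pos[of z \<alpha>] assms by (simp add: add_pos_nonneg)

lemma holomorphic_symbol_power:
  assumes "0 \<le> x" "0 \<le> \<alpha>" "\<alpha> \<le> 1"
  shows "(\<lambda>w. (1 + of_real x * (1 - w) powr (- of_real \<alpha>)) powr of_real \<mu>) holomorphic_on ball 0 1"
proof (intro holomorphic_intros)
  fix w :: complex assume "w \<in> ball 0 1"
  then have w: "0 < Re (1 - w)"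
    using complex_Re_le_cmod[of w] by simp
  then show "1 - w \<notin> \<real>\<^sub>\<le>\<^sub>0"
    by (auto simp: complex_nonpos_Reals_iff)
  show "1 + of_real x * (1 - w) powr (- of_real \<alpha>) \<notin> \<real>\<^sub>\<le>\<^sub>0"
    using Re_symbol_pos[OF w assms(2,3,1)] by (auto simp: complex_nonpos_Reals_iff)
qed

lemma gbinomial_of_real:
  "of_real (\<mu> gchoose k) = ((of_real \<mu> :: 'a::real_normed_field) gchoose k)"
  by (simp add: gbinomial_prod_rev)

text \<open>
  For \<open>x < 1\<close> the binomial series in \<open>x * u\<close> has room to let \<open>norm u\<close> exceed \<open>1\<close>; for natural
  \<open>\<mu>\<close> it is a finite sum. The condition \<open>1 + x * u \<noteq> 0\<close> is there for the case \<open>\<mu> = 0\<close>, as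
  \<open>0 powr 0 = 0\<close>.
\<close>

lemma binomial_expansion_beyond_1:
  assumes x: "0 \<le> x" and or: "x < 1 \<or> \<mu> \<in> \<nat>"
  obtains r :: real where "1 < r" "summable (\<lambda>k. \<bar>(\<mu> gchoose k) * x ^ k\<bar> * r ^ k)"
    "\<And>u :: complex. norm u \<le> r \<Longrightarrow> 1 + of_real x * u \<noteq> 0 \<Longrightarrow>
      (\<lambda>k. of_real ((\<mu> gchoose k) * x ^ k) * u ^ k) sums (1 + of_real x * u) powr of_real \<mu>"
proof (cases "\<mu> \<in> \<nat>")
  case True
  then obtain n where \<mu>: "\<mu> = real n"
    by (elim Nats_cases)
  have zero: "\<mu> gchoose k = 0" if "k \<notin> {..n}" for k
    using that by (simp add: \<mu> binomial_gbinomial[symmetric])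
  show ?thesis
  proof (rule that[of 2])
    show "summable (\<lambda>k. \<bar>(\<mu> gchoose k) * x ^ k\<bar> * 2 ^ k)"
      by (rule summable_finite[of "{..n}"]) (auto simp: zero)
    fix u :: complex assume "1 + of_real x * u \<noteq> 0"
    then have "(1 + of_real x * u) powr of_real \<mu> = (of_real x * u + 1) ^ n"
      by (simp add: \<mu> add.commute)
    also have "\<dots> = (\<Sum>k\<le>n. of_real ((\<mu> gchoose k) * x ^ k) * u ^ k)"
      unfolding binomial_ring
      by (intro sum.cong) (simp_all add: \<mu> binomial_gbinomial[symmetric] power_mult_distrib)
    finally show "(\<lambda>k. of_real ((\<mu> gchoose k) * x ^ k) * u ^ k) sums (1 + of_real x * u) powr of_real \<mu>"
      using sums_finite[of "{..n}" "\<lambda>k. of_real ((\<mu> gchoose k) * x ^ k) * u ^ k"] zero by simp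
  qed simp
next
  case False
  with or have "x < 1"
    by simp
  (* This weight exceeds 1 and still satisfies x * r < 1, because x < 1. *)
  define r where "r = 2 / (1 + x)"
  define y where "y = x * r"
  have r: "1 < r" and y: "0 \<le> y" "y < 1"
    using x \<open>x < 1\<close> by (auto simp: r_def y_def field_simps)
  show ?thesis
  proof (rule that[OF r])
    have "summable (\<lambda>k. (\<mu> gchoose k) * ((1 + y) / 2) ^ k)"
      using gen_binomial_real[of "(1 + y) / 2" \<mu>] y by (simp add: sums_iff)
    then have "summable (\<lambda>k. norm ((\<mu> gchoose k) * y ^ k))"
      by (rule powser_insidea) (use y in \<open>auto simp: field_simps\<close>)
    then show "summable (\<lambda>k. \<bar>(\<mu> gchoose k) * x ^ k\<bar> * r ^ k)"
      using x r by (simp add: y_def power_mult_distrib abs_mult power_abs mult.assoc)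
    fix u :: complex assume "norm u \<le> r"
    then have "norm (of_real x * u) \<le> y"
      using x by (simp add: y_def norm_mult mult_left_mono)
    then have "(\<lambda>k. (of_real \<mu> gchoose k) * (of_real x * u) ^ k) sums (1 + of_real x * u) powr of_real \<mu>"
      using y by (intro gen_binomial_complex) simp
    then show "(\<lambda>k. of_real ((\<mu> gchoose k) * x ^ k) * u ^ k) sums (1 + of_real x * u) powr of_real \<mu>"
      by (simp add: gbinomial_of_real power_mult_distrib mult.assoc)
  qed
qed

text \<open>
  The powers of \<open>1 - \<alpha>\<close> and \<open>B \<alpha>\<close> combine into a constant and a geometric factor, so that the
  coefficients become those of a binomial series in \<open>\<alpha> / (1 - \<alpha>)\<close>.
\<close>

lemma AB_term_eq:
  fixes f :: "real \<Rightarrow> 'a::real_normed_vector"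
  assumes \<alpha>: "0 \<le> \<alpha>" "\<alpha> < 1" and B: "0 < B \<alpha>"
  shows "AB_term B a \<alpha> \<mu> f (a + 1 + real m) k =
    (((1 - \<alpha>) / B \<alpha>) powr \<mu> * ((\<mu> gchoose k) * (\<alpha> / (1 - \<alpha>)) ^ k)) *\<^sub>R
      (\<Sum>i\<le>m. nabla_kernel (real k * \<alpha>) i *\<^sub>R f (a + 1 + real (m - i)))"
proof -
  have "(1 - \<alpha>) powr (\<mu> - real k) = (1 - \<alpha>) powr \<mu> / (1 - \<alpha>) ^ k"
    using \<alpha> by (simp add: powr_diff powr_realpow)
  moreover have "((1 - \<alpha>) / B \<alpha>) powr \<mu> = (1 - \<alpha>) powr \<mu> / B \<alpha> powr \<mu>"
    by (rule powr_divide)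
  ultimately have "(\<mu> gchoose k) * (1 - \<alpha>) powr (\<mu> - real k) * \<alpha> ^ k / B \<alpha> powr \<mu> =
      ((1 - \<alpha>) / B \<alpha>) powr \<mu> * ((\<mu> gchoose k) * (\<alpha> / (1 - \<alpha>)) ^ k)"
    by (simp add: power_divide mult_ac)
  then show ?thesis
    using \<alpha> unfolding AB_term_def by (simp only: nabla_sum_conv mult_nonneg_nonneg of_nat_0_le_iff)
qed

text \<open>
  Exchanging the series over \<open>k\<close> with the finite convolution sum makes the operator one convolution,
  with weights \<open>c powr \<mu> * g i\<close>; their generating function is known on the whole disc by
  \<open>coefficient_series\<close>.
\<close>

lemma laplace_AB_series:
  fixes f :: "real \<Rightarrow> complex"
  assumes \<alpha>: "0 \<le> \<alpha>" "\<alpha> < 1" and B: "0 < B \<alpha>" and or: "\<alpha> < 1 / 2 \<or> \<mu> \<in> \<nat>"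
    and z: "norm (1 - z) < 1" and f: "nabla_laplace_exists a f z"
  shows "nabla_laplace_exists a (AB_nabla B a \<alpha> \<mu> f) z \<and>
    nabla_laplace a (AB_nabla B a \<alpha> \<mu> f) z =
      (of_real ((1 - \<alpha>) / B \<alpha>) + of_real (\<alpha> / B \<alpha>) * z powr (- of_real \<alpha>)) powr of_real \<mu> *
      nabla_laplace a f z"
proof -
  define x where "x = \<alpha> / (1 - \<alpha>)"
  define c where "c = (1 - \<alpha>) / B \<alpha>"
  define d where "d k = (\<mu> gchoose k) * x ^ k" for k
  define h where "h w = (1 + of_real x * (1 - w) powr (- of_real \<alpha>)) powr (of_real \<mu> :: complex)" for w
  have x: "0 \<le> x" "x < 1 \<or> \<mu> \<in> \<nat>"
    using \<alpha> or by (auto simp: x_def field_simps)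
  have c: "0 < c"
    using \<alpha> B by (simp add: c_def)
  obtain r where r: "1 < r" "summable (\<lambda>k. \<bar>d k\<bar> * r ^ k)"
    and sums: "\<And>u :: complex. norm u \<le> r \<Longrightarrow> 1 + of_real x * u \<noteq> 0 \<Longrightarrow>
      (\<lambda>k. of_real (d k) * u ^ k) sums (1 + of_real x * u) powr of_real \<mu>"
    by (rule binomial_expansion_beyond_1[OF x, folded d_def]) (rule that)
  have base: "1 + of_real x * (1 - w) powr (- of_real \<alpha>) \<noteq> 0" if "norm w < 1" for w :: complex
  proof -
    have "0 < Re (1 - w)"
      using that complex_Re_le_cmod[of w] by simp
    then show ?thesis
      using Re_symbol_pos[of "1 - w" \<alpha> x] \<alpha> x(1) by force
  qed
  have expand: "(\<lambda>k. of_real (d k) * ((1 - w) powr (- of_real \<alpha>)) ^ k) sums h w"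
    if "norm w < 1" "norm ((1 - w) powr (- of_real \<alpha>)) \<le> r" for w
    unfolding h_def using that by (intro sums base)
  have holo: "h holomorphic_on ball 0 1"
    unfolding h_def using x \<alpha> by (intro holomorphic_symbol_power) auto
  have \<alpha>': "0 \<le> \<alpha>" "\<alpha> \<le> 1"
    using \<alpha> by auto
  define g where "g i = (\<Sum>k. d k * nabla_kernel (real k * \<alpha>) i)" for i
  have g: "(\<lambda>k. d k * nabla_kernel (real k * \<alpha>) i) sums g i" for i
    unfolding g_def by (intro summable_sums summable_coefficient[OF r(2,1) \<alpha>' expand])
  have g_series: "(\<lambda>n. of_real (g n) * w ^ n) sums h w" if "norm w < 1" for w
    unfolding g_def by (rule coefficient_series[OF r(2,1) \<alpha>' expand holo that])
  have conv: "AB_nabla B a \<alpha> \<mu> f (a + 1 + real m) =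
      (\<Sum>i\<le>m. (c powr \<mu> * g i) *\<^sub>R f (a + 1 + real (m - i)))" for m
  proof -
    have "(\<lambda>k. \<Sum>i\<le>m. (c powr \<mu> * (d k * nabla_kernel (real k * \<alpha>) i)) *\<^sub>R f (a + 1 + real (m - i))) sums
        (\<Sum>i\<le>m. (c powr \<mu> * g i) *\<^sub>R f (a + 1 + real (m - i)))"
      by (intro sums_sum sums_scaleR_left sums_mult g)
    then have "AB_term B a \<alpha> \<mu> f (a + 1 + real m) sums
        (\<Sum>i\<le>m. (c powr \<mu> * g i) *\<^sub>R f (a + 1 + real (m - i)))"
      by (simp add: AB_term_eq[where m = m and B = B, OF \<alpha> B, abs_def] d_def x_def c_def scaleR_sum_right mult.assoc)
    then show ?thesis
      using \<alpha> by (simp add: AB_nabla_def sums_iff)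
  qed
  have symbol_eq: "of_real (c powr \<mu>) * h (1 - z) =
      (of_real ((1 - \<alpha>) / B \<alpha>) + of_real (\<alpha> / B \<alpha>) * z powr (- of_real \<alpha>)) powr of_real \<mu>"
  proof -
    define b where "b = 1 + of_real x * z powr (- of_real \<alpha>)"
    have b: "b \<noteq> 0"
      using base[OF z] by (simp add: b_def)
    have "of_real (c powr \<mu>) * h (1 - z) = of_real c powr of_real \<mu> * b powr of_real \<mu>"
      using c by (simp add: h_def b_def powr_of_real)
    also have "\<dots> = (of_real c * b) powr of_real \<mu>"
      using b c Ln_times_of_real[of c b] by (simp add: powr_def Ln_of_real exp_add ring_distribs)
    finally have "of_real (c powr \<mu>) * h (1 - z) =
        (of_real c * (1 + of_real x * z powr (- of_real \<alpha>))) powr of_real \<mu>"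
      by (simp only: b_def)
    moreover have "\<alpha> / B \<alpha> = c * x"
      using \<alpha> by (simp add: c_def x_def)
    ultimately show ?thesis
      by (simp only: c_def[symmetric]) (simp add: ring_distribs mult.assoc)
  qed
  have "(\<lambda>n. of_real (c powr \<mu> * g n) * w ^ n) sums (of_real (c powr \<mu>) * h w)"
    if "norm w < 1" for w
    using sums_mult[OF g_series[OF that], of "of_real (c powr \<mu>)"] by (simp add: mult.assoc)
  from laplace_convolution[OF this z f conv] show ?thesis
    unfolding symbol_eq .
qed

section \<open>Where the operator series exists only trivially\<close>

text \<open>
  Unless \<open>\<mu>\<close> is a natural number, \<open>\<bar>\<mu> gchoose k\<bar> * k powr (\<mu> + 1)\<close> tends to the positive limit
  \<open>\<bar>1 / Gamma (-\<mu>)\<bar>\<close>, which bounds the sequence with \<open>M \<ge> \<mu> + 1\<close> away from \<open>0\<close>.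
\<close>

lemma gbinomial_decay_imp_nat:
  fixes \<mu> x :: real
  assumes x: "1 \<le> x" and decay: "\<And>M. (\<lambda>k. ((\<mu> gchoose k) * x ^ k) * real k ^ M) \<longlonglongrightarrow> 0"
  shows "\<mu> \<in> \<nat>"
proof (rule ccontr)
  assume \<mu>: "\<mu> \<notin> \<nat>"
  (* For negative \<mu> + 1 the exponent 0 serves. *)
  define M where "M = nat \<lceil>\<mu> + 1\<rceil>"
  define c where "c = \<bar>inverse (Gamma (- \<mu>))\<bar>"
  have "- \<mu> \<notin> \<int>\<^sub>\<le>\<^sub>0"
    using \<mu> by (auto elim!: nonpos_Ints_cases')
  then have c: "0 < c"
    by (simp add: c_def Gamma_eq_zero_iff)
  have "(\<lambda>k. \<bar>(\<mu> gchoose k) / ((-1) ^ k / exp ((\<mu> + 1) * ln (real k)))\<bar>) \<longlonglongrightarrow> c"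
    unfolding c_def using tendsto_rabs[OF gbinomial_asymptotic[of \<mu>]] by simp
  then have "eventually (\<lambda>k. c / 2 < \<bar>(\<mu> gchoose k) / ((-1) ^ k / exp ((\<mu> + 1) * ln (real k)))\<bar>) sequentially"
    by (rule order_tendstoD) (use c in simp)
  moreover have "eventually (\<lambda>k. \<bar>((\<mu> gchoose k) * x ^ k) * real k ^ M\<bar> < c / 2) sequentially"
    using tendsto_rabs[OF decay[of M]] by (rule order_tendstoD(2)) (use c in simp)
  ultimately have "eventually (\<lambda>k::nat. False) sequentially"
    using eventually_ge_at_top[of 1]
  proof eventually_elim
    case (elim k)
    have "\<mu> + 1 \<le> real M"
      unfolding M_def by (rule real_nat_ceiling_ge)
    have "exp ((\<mu> + 1) * ln (real k)) = real k powr (\<mu> + 1)"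
      using \<open>1 \<le> k\<close> by (simp add: powr_def)
    also have "\<dots> \<le> real k powr real M"
      using \<open>1 \<le> k\<close> \<open>\<mu> + 1 \<le> real M\<close> by (intro powr_mono) auto
    also have "\<dots> = real k ^ M"
      using \<open>1 \<le> k\<close> by (simp add: powr_realpow)
    finally have "\<bar>\<mu> gchoose k\<bar> * exp ((\<mu> + 1) * ln (real k)) \<le> \<bar>\<mu> gchoose k\<bar> * real k ^ M"
      by (rule mult_left_mono) simp
    also have "\<dots> \<le> (\<bar>\<mu> gchoose k\<bar> * x ^ k) * real k ^ M"
      using one_le_power[OF x, of k] by (intro mult_right_mono) (auto simp: mult_le_cancel_left1)
    also have "\<dots> = \<bar>((\<mu> gchoose k) * x ^ k) * real k ^ M\<bar>"
      using x by (simp add: abs_mult)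
    finally show False
      using elim by (simp add: abs_mult power_abs)
  qed
  then show False
    by simp
qed

text \<open>
  Let \<open>m\<close> be the index of the first nonzero value of \<open>f\<close>. At the point with index \<open>m + j\<close> the terms
  of the operator series involve the kernel at \<open>0, \<dots>, j\<close> only, and the kernel at \<open>j\<close>
  appears with the nonzero factor \<open>f (a + 1 + m)\<close>. Induction on \<open>j\<close> thus isolates the summability of
  \<open>(\<mu> gchoose k) * (\<alpha> / (1 - \<alpha>)) ^ k * nabla_kernel (k * \<alpha>) j\<close> for every \<open>j\<close>. As the kernel at
  order \<open>k * \<alpha>\<close> dominates a multiple of \<open>k ^ j\<close>, the decay required above follows.
\<close>

lemma AB_exists_imp_nat:
  fixes f :: "real \<Rightarrow> complex"
  assumes \<alpha>: "1 / 2 \<le> \<alpha>" "\<alpha> < 1" and B: "0 < B \<alpha>"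
    and ex: "AB_exists B a \<alpha> \<mu> f" and nonzero: "f (a + 1 + real n) \<noteq> 0"
  shows "\<mu> \<in> \<nat>"
proof (rule gbinomial_decay_imp_nat)
  let ?d = "\<lambda>k. (\<mu> gchoose k) * (\<alpha> / (1 - \<alpha>)) ^ k"
  define c where "c = ((1 - \<alpha>) / B \<alpha>) powr \<mu>"
  have c: "c \<noteq> 0"
    using \<alpha> B by (simp add: c_def)
  show x: "1 \<le> \<alpha> / (1 - \<alpha>)"
    using \<alpha> by (simp add: field_simps)
  define m where "m = (LEAST n. f (a + 1 + real n) \<noteq> 0)"
  have m: "f (a + 1 + real m) \<noteq> 0"
    unfolding m_def using nonzero by (rule LeastI)
  have below: "f (a + 1 + real i) = 0" if "i < m" for i
    using that not_less_Least[of i "\<lambda>n. f (a + 1 + real n) \<noteq> 0"] by (auto simp: m_def)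
  have moments: "summable (\<lambda>k. ?d k * nabla_kernel (real k * \<alpha>) j)" for j
  proof (induction j rule: less_induct)
    case (less j)
    have "a + 1 + real (m + j) \<in> nats_from a"
      unfolding nats_from_def by (rule image_eqI[of _ _ "1 + (m + j)"]) auto
    then have "summable (AB_term B a \<alpha> \<mu> f (a + 1 + real (m + j)))"
      using ex \<alpha> unfolding AB_exists_def by blast
    also have "AB_term B a \<alpha> \<mu> f (a + 1 + real (m + j)) =
        (\<lambda>k. c *\<^sub>R (\<Sum>i\<le>j. (?d k * nabla_kernel (real k * \<alpha>) i) *\<^sub>R f (a + 1 + real (m + j - i))))"
    proof
      fix k
      have "(\<Sum>i\<le>m + j. nabla_kernel (real k * \<alpha>) i *\<^sub>R f (a + 1 + real (m + j - i))) =
          (\<Sum>i\<le>j. nabla_kernel (real k * \<alpha>) i *\<^sub>R f (a + 1 + real (m + j - i)))"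
      proof (rule sum.mono_neutral_right)
        show "\<forall>i\<in>{..m + j} - {..j}. nabla_kernel (real k * \<alpha>) i *\<^sub>R f (a + 1 + real (m + j - i)) = 0"
          using below by (auto simp del: of_nat_diff)
      qed auto
      then show "AB_term B a \<alpha> \<mu> f (a + 1 + real (m + j)) k =
          c *\<^sub>R (\<Sum>i\<le>j. (?d k * nabla_kernel (real k * \<alpha>) i) *\<^sub>R f (a + 1 + real (m + j - i)))"
        using \<alpha> B by (simp only: AB_term_eq c_def) (simp add: AB_term_eq c_def scaleR_sum_right mult.assoc)
    qed
    finally have "summable (\<lambda>k. \<Sum>i\<le>j. (?d k * nabla_kernel (real k * \<alpha>) i) *\<^sub>R f (a + 1 + real (m + j - i)))"
      using c by (auto dest: summable_scaleR_right[of _ "inverse c"])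
    moreover have "summable (\<lambda>k. \<Sum>i<j. (?d k * nabla_kernel (real k * \<alpha>) i) *\<^sub>R f (a + 1 + real (m + j - i)))"
      using less by (intro summable_sum summable_scaleR_left) auto
    ultimately have "summable (\<lambda>k. (\<Sum>i\<le>j. (?d k * nabla_kernel (real k * \<alpha>) i) *\<^sub>R f (a + 1 + real (m + j - i))) -
        (\<Sum>i<j. (?d k * nabla_kernel (real k * \<alpha>) i) *\<^sub>R f (a + 1 + real (m + j - i))))"
      by (rule summable_diff)
    then have "summable (\<lambda>k. (?d k * nabla_kernel (real k * \<alpha>) j) *\<^sub>R f (a + 1 + real m))"
      by (simp add: lessThan_Suc_atMost[symmetric])
    from summable_mult2[OF this, of "inverse (f (a + 1 + real m))"]
    have "summable (\<lambda>k. of_real (?d k * nabla_kernel (real k * \<alpha>) j) :: complex)"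
      using m by (simp add: scaleR_conv_of_real mult.assoc)
    then show ?case
      by (simp only: summable_of_real_iff)
  qed
  show "(\<lambda>k. ?d k * real k ^ M) \<longlonglongrightarrow> 0" for M
  proof (rule Lim_null_comparison)
    have "(\<lambda>k. \<bar>?d k * nabla_kernel (real k * \<alpha>) M\<bar> * (fact M / \<alpha> ^ M)) \<longlonglongrightarrow> 0 * (fact M / \<alpha> ^ M)"
      by (intro tendsto_mult_right tendsto_rabs_zero summable_LIMSEQ_zero moments)
    then show "(\<lambda>k. \<bar>?d k * nabla_kernel (real k * \<alpha>) M\<bar> * (fact M / \<alpha> ^ M)) \<longlonglongrightarrow> 0"
      by simp
    have "\<bar>?d k * real k ^ M\<bar> \<le> \<bar>?d k * nabla_kernel (real k * \<alpha>) M\<bar> * (fact M / \<alpha> ^ M)" for k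
    proof -
      have "real k ^ M = ((real k * \<alpha>) ^ M / fact M) * (fact M / \<alpha> ^ M)"
        using \<alpha> by (simp add: power_mult_distrib)
      also have "\<dots> \<le> nabla_kernel (real k * \<alpha>) M * (fact M / \<alpha> ^ M)"
        using \<alpha> by (intro mult_right_mono kernel_ge_power) auto
      finally have "\<bar>?d k\<bar> * real k ^ M \<le> \<bar>?d k\<bar> * (nabla_kernel (real k * \<alpha>) M * (fact M / \<alpha> ^ M))"
        by (rule mult_left_mono) simp
      moreover have "\<bar>?d k * real k ^ M\<bar> = \<bar>?d k\<bar> * real k ^ M"
        by (simp add: abs_mult)
      moreover have "\<bar>?d k * nabla_kernel (real k * \<alpha>) M\<bar> = \<bar>?d k\<bar> * nabla_kernel (real k * \<alpha>) M"
        using \<alpha> kernel_nonneg[of "real k * \<alpha>" M] by (simp add: abs_mult)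
      ultimately show ?thesis
        by (simp only: mult.assoc)
    qed
    then show "eventually (\<lambda>k. norm (?d k * real k ^ M) \<le>
        \<bar>?d k * nabla_kernel (real k * \<alpha>) M\<bar> * (fact M / \<alpha> ^ M)) sequentially"
      by simp
  qed
qed

theorem theorem2p2:
  fixes B :: "real \<Rightarrow> real" and a \<alpha> \<mu> :: real and f :: "real \<Rightarrow> complex" and z :: complex
  assumes B_pos: "\<And>x. x \<in> {0..1} \<Longrightarrow> B x > 0"
    and B_0: "B 0 = 1"
    and B_1: "B 1 = 1"
    and alpha: "\<alpha> \<in> {0..1}"
    and operator_defined: "1 / 2 \<le> \<alpha> \<Longrightarrow> AB_exists B a \<alpha> \<mu> f"
    and z: "norm (1 - z) < 1"
    and transform_defined: "nabla_laplace_exists a f z"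
  shows "nabla_laplace_exists a (AB_nabla B a \<alpha> \<mu> f) z \<and>
    nabla_laplace a (AB_nabla B a \<alpha> \<mu> f) z =
      (complex_of_real ((1 - \<alpha>) / B \<alpha>) +
        complex_of_real (\<alpha> / B \<alpha>) * z powr (- complex_of_real \<alpha>)) powr complex_of_real \<mu> *
      nabla_laplace a f z"
proof -
  have B: "0 < B \<alpha>"
    using B_pos alpha by blast
  have z_pos: "0 < Re z"
    using complex_Re_le_cmod[of "1 - z"] z by simp
  consider (one) "\<alpha> = 1" | (series) "\<alpha> < 1" "\<alpha> < 1 / 2 \<or> \<mu> \<in> \<nat>"
    | (zero) "\<alpha> < 1" "1 / 2 \<le> \<alpha>" "\<mu> \<notin> \<nat>"
    using alpha by fastforce
  then show ?thesis
  proof cases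
    case one
    have "Ln (inverse z) = - Ln z"
      using z_pos by (intro Ln_inverse) (auto simp: complex_nonpos_Reals_iff)
    then have power: "(inverse z) powr of_real \<mu> = z powr (- of_real \<mu>)"
      using z_pos by (auto simp: powr_def)
    have "z powr - 1 = inverse z"
      using powr_minus[of z 1] by simp
    then have factor: "(of_real ((1 - \<alpha>) / B \<alpha>) + of_real (\<alpha> / B \<alpha>) * z powr (- of_real \<alpha>)) powr of_real \<mu> =
        z powr (- of_real \<mu>)"
      using one B_1 by (simp add: power)
    show ?thesis
    proof (cases "0 \<le> \<mu>")
      case True
      then have "AB_nabla B a \<alpha> \<mu> f = nabla_sum a \<mu> f"
        by (simp add: AB_nabla_def one fun_eq_iff)
      then show ?thesis
        unfolding factor using laplace_nabla_sum[OF True z transform_defined] by simp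
    next
      case False
      then have "AB_nabla B a \<alpha> \<mu> f = nabla_diff a (- \<mu>) f"
        by (simp add: AB_nabla_def one fun_eq_iff)
      then show ?thesis
        unfolding factor using laplace_nabla_diff[OF _ z transform_defined, of "- \<mu>"] False by simp
    qed
  next
    case series
    then show ?thesis
      using alpha B by (intro laplace_AB_series z transform_defined) auto
  next
    case zero
    have f0: "f (a + 1 + real n) = 0" for n
      using AB_exists_imp_nat[OF zero(2,1) B operator_defined[OF zero(2)], of n] zero(3) by blast
    have "AB_term B a \<alpha> \<mu> f (a + 1 + real m) = (\<lambda>k. 0)" for m
    proof
      show "AB_term B a \<alpha> \<mu> f (a + 1 + real m) k = 0" for k
        using alpha zero(1) B f0 by (subst AB_term_eq) (auto simp del: of_nat_diff)
    qed
    then have "AB_nabla B a \<alpha> \<mu> f (a + 1 + real m) = 0" for m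
      using zero(1) by (simp add: AB_nabla_def)
    then show ?thesis
      by (simp add: nabla_laplace_exists_def nabla_laplace_def f0)
  qed
qed

end
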